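(* For any integer $k\geq 2$, any Hausdorff space $Y$, any topological space $X$ and any continuous map $g:X\to Y$, we have $\mathrm{sec}_g(\pi_{k,1}^Y)\leq k$.
   Context: Maps are continuous. $F(Y,k)=\{(y_1,\ldots,y_k)\in Y^k\mid y_i\neq y_j\text{ whenever }i\neq j\}$ with the subspace topology from $Y^k$, and $\pi_{k,1}^Y:F(Y,k)\to Y$ is $\pi_{k,1}^Y(y_1,\ldots,y_k)=y_1$. The sectional number $\mathrm{sec}(f)$ of a map $f:A\to B$ is the minimal cardinality of open covers of $B$ such that each element $U$ of the cover admits a local section of $f$, i.e. a map $s:U\to A$ with $f\circ s$ equal to the inclusion $U\hookrightarrow B$ (with value $\infty$ if no finite such cover exists). For maps $p:E\to B$ and $g:X\to B$, the relative sectional number $\mathrm{sec}_g(p)$ is $\mathrm{sec}(g^\ast(p))$, where $g^\ast(p):X\times_B E\to X$, $(x,e)\mapsto x$, is the canonical pullback, $X\times_B E=\{(x,e)\in X\times E: g(x)=p(e)\}$. Equivalently, $\mathrm{sec}_g(p)$ is the minimal cardinality of open covers $\{U_i\}_{1\le i\le n}$ of $X$ such that for each $i$ there is a map $\sigma_i:U_i\to E$ with $p\circ\sigma_i=g_{|U_i}$.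
   Formalization: The formal statement additionally assumes that F(Y,k) is nonempty (Y has at least k points) whenever X is nonempty; otherwise, e.g. for X = Y a point and k = 2, the sectional number is infinite and the claim fails. *)

theory Defs
  imports "HOL-Analysis.Abstract_Topological_Spaces" "HOL-Library.Extended_Nat"
begin

definition local_section ::
    "'a topology \<Rightarrow> 'b topology \<Rightarrow> ('a \<Rightarrow> 'b) \<Rightarrow> 'b set \<Rightarrow> ('b \<Rightarrow> 'a) \<Rightarrow> bool" where
  "local_section A B f U s \<longleftrightarrow>
     continuous_map (subtopology B U) A s \<and> (\<forall>x\<in>U. f (s x) = x)"

definition sectional_cover ::
    "'a topology \<Rightarrow> 'b topology \<Rightarrow> ('a \<Rightarrow> 'b) \<Rightarrow> 'b set set \<Rightarrow> bool" where
  "sectional_cover A B f \<U> \<longleftrightarrow>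
     \<Union>\<U> = topspace B \<and> (\<forall>U\<in>\<U>. openin B U \<and> (\<exists>s. local_section A B f U s))"

text \<open>The infimum of the empty set in \<^typ>\<open>enat\<close> is \<open>\<infinity>\<close>, as required when no
  finite cover of this kind exists.\<close>

definition sectional_number :: "'a topology \<Rightarrow> 'b topology \<Rightarrow> ('a \<Rightarrow> 'b) \<Rightarrow> enat" where
  "sectional_number A B f =
     Inf {enat (card \<U>) |\<U>. finite \<U> \<and> sectional_cover A B f \<U>}"

definition pullback_space ::
    "'x topology \<Rightarrow> 'e topology \<Rightarrow> ('x \<Rightarrow> 'b) \<Rightarrow> ('e \<Rightarrow> 'b) \<Rightarrow> ('x \<times> 'e) topology" where
  "pullback_space X E g p = subtopology (prod_topology X E) {(x, e). g x = p e}"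

definition relative_sectional_number ::
    "'x topology \<Rightarrow> 'e topology \<Rightarrow> ('x \<Rightarrow> 'b) \<Rightarrow> ('e \<Rightarrow> 'b) \<Rightarrow> enat" where
  "relative_sectional_number X E g p = sectional_number (pullback_space X E g p) X fst"

text \<open>Points of \<open>Y\<^sup>k\<close> are functions on \<open>{1..k}\<close>, extended by \<^const>\<open>undefined\<close> elsewhere
  as in \<^const>\<open>product_topology\<close>.\<close>

definition configuration_space :: "'a topology \<Rightarrow> nat \<Rightarrow> (nat \<Rightarrow> 'a) topology" where
  "configuration_space Y k =
     subtopology (product_topology (\<lambda>_. Y) {1..k}) {y. inj_on y {1..k}}"

definition config_proj1 :: "(nat \<Rightarrow> 'a) \<Rightarrow> 'a" where
  "config_proj1 y = y 1"

end

theory Submission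
  imports Defs "HOL-Combinatorics.Transposition"
begin

text \<open>
  Fix \<open>k\<close> distinct points \<open>q 1, \<dots>, q k\<close> of \<open>Y\<close>. Every point of \<open>Y\<close> equals at most one of them, so
  the open sets \<open>Y - {q j | j \<noteq> i}\<close>, for \<open>1 \<le> i \<le> k\<close>, cover \<open>Y\<close>. Over the \<open>i\<close>-th of them, sending \<open>y\<close>
  to the configuration consisting of \<open>y\<close> and the \<open>k - 1\<close> points \<open>q j\<close>, \<open>j \<noteq> i\<close>, is a section of the
  projection. The sections are lifted along \<open>g\<close>.
\<close>

lemma sectional_number_le:
  assumes "finite I"
    and "(\<Union>i\<in>I. V i) = topspace B"
    and "\<And>i. i \<in> I \<Longrightarrow> openin B (V i)"
    and "\<And>i. i \<in> I \<Longrightarrow> \<exists>s. local_section A B f (V i) s"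
  shows "sectional_number A B f \<le> enat (card I)"
proof -
  have "sectional_cover A B f (V ` I)"
    using assms by (auto simp: sectional_cover_def)
  then have "sectional_number A B f \<le> enat (card (V ` I))"
    unfolding sectional_number_def using \<open>finite I\<close> by (intro Inf_lower) blast
  also have "\<dots> \<le> enat (card I)"
    using \<open>finite I\<close> by (simp add: card_image_le)
  finally show ?thesis .
qed

text \<open>Universal property of the pullback: the lifting equation puts the graph of a partial
  lift of \<open>g\<close> inside the fibre product.\<close>

lemma local_section_pullback_space:
  assumes "continuous_map (subtopology X U) E \<sigma>"
    and "\<And>x. x \<in> U \<Longrightarrow> p (\<sigma> x) = g x"
  shows "local_section (pullback_space X E g p) X fst U (\<lambda>x. (x, \<sigma> x))"
  unfolding local_section_def pullback_space_def continuous_map_in_subtopology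
  using assms
  by (auto simp: continuous_map_pairedI continuous_map_from_subtopology)

lemma relative_sectional_number_le:
  assumes "finite I"
    and "(\<Union>i\<in>I. V i) = topspace X"
    and "\<And>i. i \<in> I \<Longrightarrow> openin X (V i)"
    and "\<And>i. i \<in> I \<Longrightarrow> continuous_map (subtopology X (V i)) E (\<sigma> i)"
    and "\<And>i x. i \<in> I \<Longrightarrow> x \<in> V i \<Longrightarrow> p (\<sigma> i x) = g x"
  shows "relative_sectional_number X E g p \<le> enat (card I)"
  unfolding relative_sectional_number_def
proof (rule sectional_number_le)
  show "\<exists>s. local_section (pullback_space X E g p) X fst (V i) s" if "i \<in> I" for i
    using local_section_pullback_space assms(4,5) that by blast
qed (use assms in auto)

lemma topspace_configuration_space:
  "topspace (configuration_space Y k) = {y \<in> {1..k} \<rightarrow>\<^sub>E topspace Y. inj_on y {1..k}}"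
  by (auto simp: configuration_space_def)

lemma continuous_map_configuration_space:
  "continuous_map X (configuration_space Y k) f \<longleftrightarrow>
     f \<in> topspace X \<rightarrow> extensional {1..k} \<and>
     (\<forall>j\<in>{1..k}. continuous_map X Y (\<lambda>x. f x j)) \<and>
     (\<forall>x\<in>topspace X. inj_on (f x) {1..k})"
  by (auto simp: configuration_space_def continuous_map_in_subtopology
      continuous_map_componentwise Pi_iff)

text \<open>Swapping 1 and \<open>i\<close> maps the slots \<open>2..k\<close> bijectively onto the
  indices other than \<open>i\<close>: slot \<open>i\<close> receives \<open>q 1\<close> and all
  other slots keep their own point. This frees slot 1 for \<open>y\<close> while leaving out exactly
  \<open>q i\<close>.\<close>

definition insert_config :: "nat \<Rightarrow> (nat \<Rightarrow> 'a) \<Rightarrow> nat \<Rightarrow> 'a \<Rightarrow> nat \<Rightarrow> 'a" where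
  "insert_config k q i y =
     (\<lambda>j\<in>{1..k}. if j = 1 then y else q (Transposition.transpose 1 i j))"

lemma transpose_mem_Diff:
  assumes "i \<in> A" "a \<in> A" "j \<in> A - {a}"
  shows "Transposition.transpose a i j \<in> A - {i}"
  using assms by (auto simp: Transposition.transpose_def)

lemma inj_on_insert_config:
  assumes "i \<in> {1..k}" and "inj_on q {1..k}" and "y \<notin> q ` ({1..k} - {i})"
  shows "inj_on (insert_config k q i y) {1..k}"
proof (rule inj_onI)
  fix a b
  assume ab: "a \<in> {1..k}" "b \<in> {1..k}"
    and eq: "insert_config k q i y a = insert_config k q i y b"
  have mem: "Transposition.transpose 1 i j \<in> {1..k} - {i}" if "j \<in> {1..k}" "j \<noteq> 1" for j
    using transpose_mem_Diff[of i "{1..k}" 1 j] that assms(1) by auto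
  have neq: "q (Transposition.transpose 1 i j) \<noteq> y" if "j \<in> {1..k}" "j \<noteq> 1" for j
    using mem[OF that] assms(3) by blast
  consider "a = 1" "b = 1" | "a \<noteq> 1" "b \<noteq> 1" | "(a = 1) \<noteq> (b = 1)"
    by blast
  then show "a = b"
  proof cases
    case 2
    then have "q (Transposition.transpose 1 i a) = q (Transposition.transpose 1 i b)"
      using eq ab by (simp add: insert_config_def)
    then have "Transposition.transpose 1 i a = Transposition.transpose 1 i b"
      using inj_onD[OF assms(2)] mem ab 2 by blast
    then show ?thesis
      by (metis transpose_involutory)
  next
    \<comment> \<open>Exactly one of the two slots holds \<open>y\<close>, so equal entries would
      make \<open>y\<close> one of the points that it avoids.\<close>
    case 3
    then show ?thesis
      using eq ab neq by (auto simp: insert_config_def split: if_splits)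
  qed auto
qed

text \<open>Continuity is checked coordinatewise: the first coordinate is \<open>g\<close> and every
  other one is constant. The avoidance condition keeps the values inside the configuration
  space.\<close>

lemma continuous_map_insert_config:
  assumes i: "i \<in> {1..k}" and q: "q \<in> topspace (configuration_space Y k)"
    and g: "continuous_map X Y g"
    and avoid: "\<And>x. x \<in> topspace X \<Longrightarrow> g x \<notin> q ` ({1..k} - {i})"
  shows "continuous_map X (configuration_space Y k) (\<lambda>x. insert_config k q i (g x))"
  unfolding continuous_map_configuration_space
proof (intro conjI ballI)
  fix j assume j: "j \<in> {1..k}"
  show "continuous_map X Y (\<lambda>x. insert_config k q i (g x) j)"
  proof (cases "j = 1")
    case True
    then show ?thesis using g j by (simp add: insert_config_def)
  next
    case False
    then have "Transposition.transpose 1 i j \<in> {1..k}"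
      using transpose_mem_Diff[of i "{1..k}" 1 j] i j by auto
    then have "q (Transposition.transpose 1 i j) \<in> topspace Y"
      using q unfolding topspace_configuration_space by blast
    then show ?thesis using False j by (simp add: insert_config_def)
  qed
next
  fix x assume "x \<in> topspace X"
  then show "inj_on (insert_config k q i (g x)) {1..k}"
    using q unfolding topspace_configuration_space by (intro inj_on_insert_config i avoid) auto
qed (simp add: insert_config_def)

text \<open>The last assumption rules out an empty configuration space over a nonempty
  \<open>X\<close>. In that case no nonempty open set would carry a lift, and the relative sectional
  number would be \<infinity>.\<close>

theorem lemma2p12:
  fixes X :: "'x topology" and Y :: "'y topology" and g :: "'x \<Rightarrow> 'y" and k :: nat
  assumes "k \<ge> 2"
    and "Hausdorff_space Y"
    and "continuous_map X Y g"
    and "topspace X \<noteq> {} \<Longrightarrow> topspace (configuration_space Y k) \<noteq> {}"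
  shows "relative_sectional_number X (configuration_space Y k) g config_proj1 \<le> enat k"
proof (cases "topspace X = {}")
  case True
  \<comment> \<open>The empty family covers the empty space, so no configuration has to be chosen
    here.\<close>
  have "relative_sectional_number X (configuration_space Y k) g config_proj1
      \<le> enat (card ({} :: nat set))"
    by (rule relative_sectional_number_le[where V = "\<lambda>_. {}"]) (use True in auto)
  also have "\<dots> \<le> enat k" by simp
  finally show ?thesis .
next
  case False
  then obtain q where q: "q \<in> topspace (configuration_space Y k)"
    using assms(4) by blast
  then have inj: "inj_on q {1..k}" and q_in: "q ` {1..k} \<subseteq> topspace Y"
    by (auto simp: topspace_configuration_space)
  define V where "V i = {x \<in> topspace X. g x \<in> topspace Y - q ` ({1..k} - {i})}" for i
  have "relative_sectional_number X (configuration_space Y k) g config_proj1 \<le> enat (card {1..k})"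
  proof (rule relative_sectional_number_le)
    show "(\<Union>i\<in>{1..k}. V i) = topspace X"
    proof (intro equalityI subsetI)
      fix x assume x: "x \<in> topspace X"
      then have gx: "g x \<in> topspace Y"
        using assms(3) by (auto simp: continuous_map_def)
      show "x \<in> (\<Union>i\<in>{1..k}. V i)"
      proof (cases "g x \<in> q ` {1..k}")
        case True
        then obtain i where "i \<in> {1..k}" "g x = q i" by blast
        moreover from this have "g x \<notin> q ` ({1..k} - {i})"
          using inj by (auto dest: inj_onD)
        ultimately show ?thesis using x gx unfolding V_def by blast
      next
        case False
        \<comment> \<open>A point whose image misses all \<open>q j\<close> lies in every
          \<open>V i\<close>; index 1 is an arbitrary choice.\<close>
        moreover have "1 \<in> {1..k}" using \<open>k \<ge> 2\<close> by simp
        ultimately show ?thesis using x gx unfolding V_def by blast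
      qed
    qed (auto simp: V_def)
    fix i assume i: "i \<in> {1..k}"
    \<comment> \<open>The Hausdorff property enters here: finite sets are closed, so
      \<open>V i\<close> is the preimage of an open set.\<close>
    have "closedin Y (q ` ({1..k} - {i}))"
      using assms(2) q_in
      by (intro closedin_Hausdorff_finite) auto
    then show "openin X (V i)"
      unfolding V_def by (intro openin_continuous_map_preimage[OF assms(3)]) blast
    show "continuous_map (subtopology X (V i)) (configuration_space Y k)
        (\<lambda>x. insert_config k q i (g x))"
      using i q assms(3)
      by (intro continuous_map_insert_config continuous_map_from_subtopology) (auto simp: V_def)
    show "config_proj1 (insert_config k q i (g x)) = g x" for x
      using \<open>k \<ge> 2\<close> by (simp add: config_proj1_def insert_config_def)
  qed simp
  then show ?thesis by simp
qed

end
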